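(* Let $T=(K,L,R)$ with $L=(1,-1)$, and let $(b_T(n))_{n\in\mathbb N_0}$ be any sequence associated with $T$. Let $p$ be a prime number with $3\le p\le \overline{\deg}\,K-u+1$ and $p\nmid r$, where $r=\sum_{j=0}^u r_j$. Then the congruence $b_T(n)\equiv0\pmod p$ has infinitely many solutions $n\in\mathbb N$.
   Context: Let $K=(k_n)_{n\in\mathbb N_0}$ be a strictly increasing sequence of non-negative integers with $k_0=0$; set $k_{-n}=-n$ for $n\in\mathbb N$. Let $L=(l_0,\dots,l_t)$ and $R=(r_0,\dots,r_u)$ be finite sequences of integers and $T=(K,L,R)$. A sequence of integers $(b_T(n))_{n\in\mathbb N_0}$, extended by $b_T(q)=0$ for negative integers $q$, is associated with $T$ if for every $n\in\mathbb N_0$: (a) $b_T(k_n)=b_T(k_n+1)=\dots=b_T(k_{n+1}-1)$, and (b) $\sum_{i=0}^{t}l_ib_T(k_{n-i})=\sum_{j=0}^{u}r_jb_T(n-j)$ (initial values are otherwise arbitrary). The upper degree of $K$ is $\overline{\deg}\,K=\sup\{d\in\mathbb N:\ k_n-k_{n-1}\ge d \text{ for infinitely many } n\}$ (possibly $\infty$). *)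

theory Defs
  imports "HOL-Library.Extended_Real" "HOL-Number_Theory.Cong" "HOL-Computational_Algebra.Primes"
begin

text \<open>The convention \<open>k\<^sub>-\<^sub>n = -n\<close> for \<open>n \<ge> 1\<close>: at a negative index \<open>q\<close> the extended sequence has the value \<open>q\<close>.\<close>

definition ext_K :: "(nat \<Rightarrow> nat) \<Rightarrow> int \<Rightarrow> int" where
  "ext_K k q = (if q < 0 then q else int (k (nat q)))"

definition ext_b :: "(nat \<Rightarrow> int) \<Rightarrow> int \<Rightarrow> int" where
  "ext_b b q = (if q < 0 then 0 else b (nat q))"

text \<open>The finite sequences \<open>(l\<^sub>0, \<dots>, l\<^sub>t)\<close> and \<open>(r\<^sub>0, \<dots>, r\<^sub>u)\<close> are lists, of lengths \<open>t + 1\<close> and \<open>u + 1\<close>.\<close>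

definition associated :: "(nat \<Rightarrow> nat) \<Rightarrow> int list \<Rightarrow> int list \<Rightarrow> (nat \<Rightarrow> int) \<Rightarrow> bool" where
  "associated k L R b \<longleftrightarrow>
     (\<forall>n. (\<forall>m\<in>{k n..<k (n + 1)}. b m = b (k n)) \<and>
          (\<Sum>i<length L. L ! i * ext_b b (ext_K k (int n - int i))) =
          (\<Sum>j<length R. R ! j * ext_b b (int n - int j)))"

definition upper_deg :: "(nat \<Rightarrow> nat) \<Rightarrow> enat" where
  "upper_deg k =
     Sup {enat d |d. d \<ge> 1 \<and> infinite {n::nat. ext_K k (int n) - ext_K k (int n - 1) \<ge> int d}}"

end

theory Submission
  imports Defs
begin

text \<open>
  On a block \<open>{k m..<k (m + 1)}\<close> the sequence \<open>b\<close> has a constant value \<open>c\<close>, so as long as the window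
  \<open>{n - u..n}\<close> stays inside the block, the recurrence reads \<open>b (k n) - b (k (n - 1)) = r * c\<close>. A block
  of length at least \<open>p + u - 1\<close> therefore yields \<open>p\<close> terms of \<open>b\<close> in arithmetic progression with
  difference \<open>r * c\<close>: either \<open>p\<close> divides \<open>c\<close>, or the progression meets every residue class.
\<close>

text \<open>Since \<open>d\<close> is a unit modulo \<open>p\<close>, the index is the residue of
  \<open>- a\<close> times an inverse of \<open>d\<close>.\<close>

lemma prime_dvd_arithmetic_progression:
  fixes a d :: int and p :: nat
  assumes "prime p" "\<not> int p dvd d"
  obtains i where "i < p" "int p dvd a + int i * d"
proof -
  have p: "0 < int p" using assms(1) prime_gt_0_nat by simp
  have "coprime d (int p)"
    using assms by (metis coprime_commute prime_imp_coprime prime_nat_int_transfer)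
  then obtain x where x: "[d * x = 1] (mod int p)"
    using cong_solve_coprime_int by blast
  define i where "i = nat ((- a * x) mod int p)"
  have i: "int i = (- a * x) mod int p"
    using p by (simp add: i_def)
  have "[a + int i * d = a + (- a * x) * d] (mod int p)"
    unfolding i by (intro cong_add cong_mult) (auto simp: cong_def)
  also have "a + (- a * x) * d = a + - a * (d * x)"
    by (simp add: mult_ac)
  also have "[a + - a * (d * x) = a + - a * 1] (mod int p)"
    by (intro cong_add cong_mult x cong_refl)
  finally have "int p dvd a + int i * d"
    by (simp add: cong_0_iff)
  moreover have "i < p"
    using p i by (metis of_nat_less_iff pos_mod_bound)
  ultimately show ?thesis using that by blast
qed

text \<open>Lying strictly below the supremum, \<open>d - 1\<close> is exceeded by some admissible
  \<open>e\<close>; this treats finite and infinite degree alike.\<close>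

lemma infinite_gaps_if_le_upper_deg:
  assumes "1 \<le> d" "enat d \<le> upper_deg k"
  shows "infinite {n::nat. int d \<le> ext_K k (int n) - ext_K k (int n - 1)}"
proof -
  have "enat (d - 1) < upper_deg k"
    using assms by (cases "upper_deg k") auto
  then obtain e where e: "d - 1 < e"
    "infinite {n::nat. int e \<le> ext_K k (int n) - ext_K k (int n - 1)}"
    by (auto simp: upper_deg_def less_Sup_iff)
  show ?thesis
    using e(1) by (intro infinite_super[OF _ e(2)]) auto
qed

text \<open>The bound on \<open>u\<close> keeps every index \<open>Suc n - j\<close> free of
  truncation, so the extension of \<open>b\<close> by zero never enters.\<close>

lemma associated_diff:
  assumes "associated k [1, -1] R b" "length R = u + 1" "u \<le> Suc n"
  shows "b (k (Suc n)) = b (k n) + (\<Sum>j\<le>u. R ! j * b (Suc n - j))"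
proof -
  have "(\<Sum>i<length [1, -1 :: int]. [1, -1] ! i * ext_b b (ext_K k (int (Suc n) - int i))) =
        (\<Sum>j<u + 1. R ! j * ext_b b (int (Suc n) - int j))"
    using assms(1) unfolding associated_def assms(2) by blast
  moreover have "(\<Sum>j<u + 1. R ! j * ext_b b (int (Suc n) - int j)) =
                 (\<Sum>j\<le>u. R ! j * b (Suc n - j))"
    using assms(3) by (intro sum.cong) (auto simp: ext_b_def nat_diff_distrib nat_add_distrib)
  moreover have "ext_b b (ext_K k (int (Suc n))) = b (k (Suc n))"
    "ext_b b (ext_K k (int n)) = b (k n)"
    by (simp_all only: ext_b_def ext_K_def nat_int) simp_all
  ultimately show ?thesis
    by simp
qed

lemma associated_arithmetic_progression:
  assumes "associated k [1, -1] R b" "length R = u + 1"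
    and block: "k m + u + i \<le> k (Suc m)" and "1 \<le> k m + u"
  shows "b (k (k m + u - 1 + i)) = b (k (k m + u - 1)) + int i * ((\<Sum>j\<le>u. R ! j) * b (k m))"
  using block
proof (induction i)
  case (Suc i)
  let ?n = "k m + u - 1 + i"
  have "b (Suc ?n - j) = b (k m)" if "j \<le> u" for j
  proof -
    \<comment> \<open>As \<open>Suc ?n = k m + u + i\<close>, the window runs from
      \<open>k m + i\<close> to \<open>k m + u + i\<close>, which \<open>Suc.prems\<close> puts
      below \<open>k (m + 1)\<close>.\<close>
    have "Suc ?n - j \<in> {k m..<k (m + 1)}"
      using assms(4) Suc.prems that by auto
    then show ?thesis
      using assms(1) unfolding associated_def by blast
  qed
  then have "(\<Sum>j\<le>u. R ! j * b (Suc ?n - j)) = (\<Sum>j\<le>u. R ! j) * b (k m)"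
    by (simp add: sum_distrib_right)
  moreover have "u \<le> Suc ?n"
    using assms(4) by simp
  ultimately have "b (k (Suc ?n)) = b (k ?n) + (\<Sum>j\<le>u. R ! j) * b (k m)"
    using associated_diff[OF assms(1,2)] by simp
  then show ?case
    using Suc by (simp add: algebra_simps)
qed simp

theorem theorem2:
  fixes k :: "nat \<Rightarrow> nat" and R :: "int list" and b :: "nat \<Rightarrow> int" and u p :: nat and r :: int
  assumes "strict_mono k" and "k 0 = 0"
    and "length R = u + 1"
    and "associated k [1, -1] R b"
    and "r = (\<Sum>j\<le>u. R ! j)"
    and "prime p" and "3 \<le> p"
    and "ereal (real p) \<le> ereal_of_enat (upper_deg k) - ereal (real u) + 1"
    and "\<not> int p dvd r"
  shows "infinite {n::nat. n \<ge> 1 \<and> [b n = 0] (mod int p)}"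
  unfolding infinite_nat_iff_unbounded_le
proof
  fix N
  have k_ge: "n \<le> k n" for n
    using assms(1) by (rule strict_mono_imp_increasing)
  have "enat (p + u - 1) \<le> upper_deg k"
    using assms(7,8) by (cases "upper_deg k") (auto simp: one_ereal_def)
  then have "infinite {n::nat. int (p + u - 1) \<le> ext_K k (int n) - ext_K k (int n - 1)}"
    using assms(7) by (intro infinite_gaps_if_le_upper_deg) auto
  \<comment> \<open>The margin 3 gives \<open>k m \<ge> N + 2\<close> for \<open>n = Suc m\<close>,
    so \<open>k m + u - 1\<close> is at least \<open>N + 1\<close> even when
    \<open>u = 0\<close>.\<close>
  then obtain n where n: "N + 3 \<le> n" "int (p + u - 1) \<le> ext_K k (int n) - ext_K k (int n - 1)"
    unfolding infinite_nat_iff_unbounded_le by blast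
  then obtain m where m: "n = Suc m" "N + 2 \<le> m"
    by (cases n) auto
  have gap: "k m + (p + u - 1) \<le> k (Suc m)"
    using n(2) assms(7) by (simp add: m(1) ext_K_def nat_add_distrib)
  have km: "N + 2 \<le> k m"
    using k_ge[of m] m(2) by simp
  show "\<exists>n\<ge>N. n \<in> {n. n \<ge> 1 \<and> [b n = 0] (mod int p)}"
  proof (cases "int p dvd b (k m)")
    case True
    then show ?thesis
      using km by (intro exI[of _ "k m"]) (auto simp: cong_0_iff)
  next
    case False
    then have "\<not> int p dvd r * b (k m)"
      using assms(6,9) by (simp add: prime_dvd_mult_iff)
    then obtain i where i: "i < p" "int p dvd b (k (k m + u - 1)) + int i * (r * b (k m))"
      using prime_dvd_arithmetic_progression assms(6) by blast
    \<comment> \<open>From \<open>i \<le> p - 1\<close> the gap yields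
      \<open>k m + u + i \<le> k (Suc m)\<close>: the block is just long enough for all
      \<open>p\<close> terms.\<close>
    have "b (k (k m + u - 1 + i)) = b (k (k m + u - 1)) + int i * (r * b (k m))"
      unfolding assms(5) using i(1) gap km
      by (intro associated_arithmetic_progression[OF assms(4,3)]) auto
    moreover have "N + 1 \<le> k (k m + u - 1 + i)"
      using k_ge[of "k m + u - 1 + i"] km by simp
    ultimately show ?thesis
      using i(2) by (intro exI[of _ "k (k m + u - 1 + i)"]) (auto simp: cong_0_iff)
  qed
qed

end
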